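(* Let $H=[h_1,h_2,\dots]$ be a transcendental semigroup. Then $BU(H)\cap J(H)\neq\emptyset$.
   Context: A transcendental semigroup $H=[h_1,h_2,\dots]$ is the semigroup, under composition, generated by a (finite or countable) family $\{h_1,h_2,\dots\}$ of transcendental entire functions, i.e. the set of all finite compositions of the generators. The set $H$ is countable and infinite; let $(g_n)_{n\ge 1}$ be an enumeration of the elements of $H$ without repetition. The Fatou set $F(H)$ is the largest open subset of $\mathbb{C}$ on which the family $H$ is normal, where normal means that every sequence in $H$ has a subsequence converging locally uniformly either to a holomorphic (meromorphic) function or to the constant $\infty$. The Julia set is $J(H)=\mathbb{C}\setminus F(H)$. The bungee set $BU(H)$ is the set of all $z\in\mathbb{C}$ for which there exist subsequences $(g_{m_k})$ and $(g_{n_k})$ of $(g_n)$, with $m_k,n_k\to\infty$ as $k\to\infty$, and a constant $R>0$ such that $|g_{m_k}(z)|<R$ for all $k$ and $|g_{n_k}(z)|\to\infty$ as $k\to\infty$. *)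

theory Defs
  imports "HOL-Complex_Analysis.Complex_Analysis"
    "HOL-Computational_Algebra.Polynomial"
begin

definition transcendental_entire :: "(complex \<Rightarrow> complex) \<Rightarrow> bool" where
  "transcendental_entire f \<longleftrightarrow> f holomorphic_on UNIV \<and> \<not> (\<exists>p. \<forall>z. f z = poly p z)"

text \<open>Only non-empty compositions occur: the identity is not adjoined.\<close>

inductive_set comp_semigroup :: "('a \<Rightarrow> 'a) set \<Rightarrow> ('a \<Rightarrow> 'a) set"
  for G :: "('a \<Rightarrow> 'a) set" where
  gen: "h \<in> G \<Longrightarrow> h \<in> comp_semigroup G"
| comp: "f \<in> comp_semigroup G \<Longrightarrow> g \<in> comp_semigroup G \<Longrightarrow> f \<circ> g \<in> comp_semigroup G"

text \<open>Locally uniform convergence on an open subset of the plane is uniform convergence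
  on its compact subsets.\<close>

definition loc_unif_to_fun ::
  "complex set \<Rightarrow> (nat \<Rightarrow> complex \<Rightarrow> complex) \<Rightarrow> (complex \<Rightarrow> complex) \<Rightarrow> bool" where
  "loc_unif_to_fun U F f \<longleftrightarrow>
     (\<forall>K. compact K \<longrightarrow> K \<subseteq> U \<longrightarrow> uniform_limit K F f sequentially)"

definition loc_unif_to_infinity :: "complex set \<Rightarrow> (nat \<Rightarrow> complex \<Rightarrow> complex) \<Rightarrow> bool" where
  "loc_unif_to_infinity U F \<longleftrightarrow>
     (\<forall>K. compact K \<longrightarrow> K \<subseteq> U \<longrightarrow>
        (\<forall>B. \<forall>\<^sub>F n in sequentially. \<forall>z\<in>K. norm (F n z) > B))"

text \<open>For families of entire functions no meromorphic limits with poles arise: a locally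
  uniform limit in the spherical metric on a domain is holomorphic or identically infinite.\<close>

definition normal_on :: "complex set \<Rightarrow> (complex \<Rightarrow> complex) set \<Rightarrow> bool" where
  "normal_on U H \<longleftrightarrow>
     (\<forall>F :: nat \<Rightarrow> complex \<Rightarrow> complex. range F \<subseteq> H \<longrightarrow>
        (\<exists>r :: nat \<Rightarrow> nat. strict_mono r \<and>
           ((\<exists>f. f holomorphic_on U \<and> loc_unif_to_fun U (F \<circ> r) f) \<or>
            loc_unif_to_infinity U (F \<circ> r))))"

text \<open>The largest open set of normality is the union of all open sets on which the family
  is normal, i.e. the set of points having a neighbourhood on which it is normal. (Limits are
  thus chosen locally: a sequence may tend to infinity on one component of the Fatou set
  and to a holomorphic function on another.)\<close>

definition fatou_set :: "(complex \<Rightarrow> complex) set \<Rightarrow> complex set" where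
  "fatou_set H = \<Union>{U. open U \<and> normal_on U H}"

definition julia_set :: "(complex \<Rightarrow> complex) set \<Rightarrow> complex set" where
  "julia_set H = - fatou_set H"

definition bungee_seq :: "(nat \<Rightarrow> complex \<Rightarrow> complex) \<Rightarrow> complex set" where
  "bungee_seq g =
     {z. \<exists>(m :: nat \<Rightarrow> nat) (n :: nat \<Rightarrow> nat) (R :: real).
           strict_mono m \<and> strict_mono n \<and> R > 0 \<and>
           (\<forall>k. norm (g (m k) z) < R) \<and>
           filterlim (\<lambda>k. norm (g (n k) z)) at_top sequentially}"

text \<open>The choice of the enumeration is immaterial; see \<open>bungee_set_eq\<close> below.\<close>

definition bungee_set :: "(complex \<Rightarrow> complex) set \<Rightarrow> complex set" where
  "bungee_set H = {z. \<exists>g. bij_betw g UNIV H \<and> z \<in> bungee_seq g}"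

lemma inj_nat_strict_mono_subseq:
  fixes s :: "nat \<Rightarrow> nat"
  assumes "inj s"
  obtains r :: "nat \<Rightarrow> nat" where "strict_mono r" "strict_mono (s \<circ> r)"
proof -
  obtain r where r: "strict_mono r" "monoseq (\<lambda>n. s (r n))"
    using seq_monosub by blast
  have inj: "inj (\<lambda>n. s (r n))"
    using inj_compose[OF assms strict_mono_imp_inj_on[OF r(1)]] by (simp add: comp_def)
  have "\<not> decseq (\<lambda>n. s (r n))"
  proof
    assume "decseq (\<lambda>n. s (r n))"
    then have "range (\<lambda>n. s (r n)) \<subseteq> {..s (r 0)}"
      by (auto simp: decseq_def)
    then have "finite (range (\<lambda>n. s (r n)))"
      by (rule finite_subset) simp
    with inj show False
      using finite_imageD infinite_UNIV_nat by blast
  qed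
  then have "mono (\<lambda>n. s (r n))"
    using r(2) by (simp add: monoseq_iff)
  then have "strict_mono (s \<circ> r)"
    using inj by (simp add: strict_mono_iff_mono comp_def)
  with r(1) show ?thesis by (rule that)
qed

lemma bungee_seq_subset:
  assumes "bij_betw g UNIV H" "bij_betw g' UNIV H"
  shows "bungee_seq g \<subseteq> bungee_seq g'"
proof
  fix z assume "z \<in> bungee_seq g"
  then obtain m n :: "nat \<Rightarrow> nat" and R :: real
    where mn: "strict_mono m" "strict_mono n" and R: "R > 0" "\<forall>k. norm (g (m k) z) < R"
      and lim: "filterlim (\<lambda>k. norm (g (n k) z)) at_top sequentially"
    unfolding bungee_seq_def by blast
  define p where "p = inv_into UNIV g' \<circ> g"
  have p: "bij p"
    unfolding p_def using assms bij_betw_inv_into bij_betw_trans by blast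
  have g: "g' (p i) = g i" for i
    proof -
    have "g i \<in> range g'"
      using assms by (auto simp: bij_betw_def)
    then show ?thesis
      by (simp add: p_def f_inv_into_f)
  qed
  have "inj (p \<circ> m)" "inj (p \<circ> n)"
    using inj_compose[OF bij_is_inj[OF p] strict_mono_imp_inj_on] mn by blast+
  then obtain a b :: "nat \<Rightarrow> nat" where a: "strict_mono (p \<circ> m \<circ> a)"
    and b: "strict_mono b" "strict_mono (p \<circ> n \<circ> b)"
    by (metis inj_nat_strict_mono_subseq)
  have "filterlim (\<lambda>k. norm (g (n (b k)) z)) at_top sequentially"
    using filterlim_compose[OF lim filterlim_subseq[OF b(1)]] .
  then show "z \<in> bungee_seq g'"
    unfolding bungee_seq_def mem_Collect_eq using a b(2) R
    by (intro exI[of _ "p \<circ> m \<circ> a"] exI[of _ "p \<circ> n \<circ> b"] exI[of _ R]) (simp add: g)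
qed

lemma bungee_set_eq:
  assumes "bij_betw g UNIV H"
  shows "bungee_set H = bungee_seq g"
  using assms bungee_seq_subset unfolding bungee_set_def by blast

end

theory Submission
  imports Defs
begin

text \<open>
  It suffices to look at a single generator \<open>f\<close>. Its iterates belong to the semigroup, so its Julia
  set is contained in that of the semigroup (\<open>julia_set_mono\<close>). If the orbit of a point under \<open>f\<close>
  returns to a bounded set infinitely often and is unbounded, then the iterates are pairwise
  distinct elements of the semigroup, and the point lies in the bungee set
  (\<open>bungee_set_if_oscillating_orbit\<close>). So one has to find such an oscillating orbit in the Julia set
  \<open>J\<close> of \<open>f\<close>.

  By Montel's normality test, the images of any neighbourhood of a point of \<open>J\<close> hit, at
  arbitrarily late times, one of any two prescribed points of \<open>J\<close>, and they do so at points of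
  \<open>J\<close>, as \<open>J\<close> is backward invariant (\<open>julia_set_blow_up\<close>). If \<open>J\<close> is unbounded, then both a
  visit to a suitable disc at a late time and a visit to the outside of a large disc at a late time are
  open dense conditions in \<open>J\<close>, and Baire's theorem gives a point that satisfies all of them.

  That \<open>J\<close> is unbounded (\<open>unbounded_julia_set\<close>) is the classical theorem of Fatou, proved
  here in two steps. First, close to infinity there is a point with an orbit of at most two points:
  otherwise Picard's great theorem controls the quotient of \<open>f (f z) - z\<close> by \<open>f z - z\<close> at infinity
  so well that \<open>f\<close> is a translation (\<open>period_two_near_infinity\<close>). If \<open>J\<close> were bounded, this bounded orbit
  would force the iterates to be locally bounded near infinity, by normality and connectedness,
  and by the maximum principle in the whole plane. Secondly, that is impossible: there would be
  arbitrarily large compact sets without holes mapped into themselves, and Schottky's theorem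
  would bound the growth of \<open>f\<close> linearly (\<open>linear_growth_of_locally_bounded_iterates\<close>).
\<close>

section \<open>Transcendental entire functions near infinity\<close>

lemma entire_compose:
  assumes "f holomorphic_on UNIV" "g holomorphic_on S"
  shows "(\<lambda>x. f (g x)) holomorphic_on S"
  using holomorphic_on_compose_gen[OF assms(2,1)] by (simp add: comp_def)

lemma transcendental_not_constant:
  assumes "transcendental_entire f"
  shows "\<not> f constant_on UNIV"
proof
  assume "f constant_on UNIV"
  then obtain c where "\<And>z. f z = c"
    by (auto simp: constant_on_def)
  then have "\<forall>z. f z = poly [:c:] z"
    by simp
  with assms show False
    unfolding transcendental_entire_def by blast
qed

lemma transcendental_not_affine:
  assumes "transcendental_entire f"
  shows "\<not> (\<forall>z. f z = a + b * z)"
proof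
  assume "\<forall>z. f z = a + b * z"
  then have "\<forall>z. f z = poly [:a, b:] z"
    by (simp add: algebra_simps)
  with assms show False
    unfolding transcendental_entire_def by blast
qed

text \<open>The point at infinity is an essential singularity of \<open>f\<close>, since a finite limit makes
  \<open>f\<close> constant and a pole makes it a polynomial; so the great Picard theorem applies to
  \<open>f (1 / x)\<close> at \<open>0\<close>. The solutions of \<open>f z = w\<close> accumulate only at infinity.\<close>

lemma transcendental_frequently_eq:
  assumes f: "transcendental_entire f"
  obtains a where "\<And>w. w \<noteq> a \<Longrightarrow> \<exists>\<^sub>F z in at_infinity. f z = w"
proof -
  have hol: "f holomorphic_on UNIV"
    using f by (simp add: transcendental_entire_def)
  have "\<not> ((f \<circ> inverse) \<longlongrightarrow> l) (at 0)" for l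
  proof
    assume "((f \<circ> inverse) \<longlongrightarrow> l) (at 0)"
    then have "(f \<longlongrightarrow> l) at_infinity"
      by (simp add: lim_at_infinity_0 comp_def)
    then have "\<And>z. f z = l"
      using Liouville_weak[OF hol] by blast
    then show False
      using transcendental_not_constant[OF f] by (auto simp: constant_on_def)
  qed
  moreover have "\<not> ((inverse \<circ> (f \<circ> inverse)) \<longlongrightarrow> l) (at 0)" for l
  proof
    assume "((inverse \<circ> (f \<circ> inverse)) \<longlongrightarrow> l) (at 0)"
    then have "((inverse \<circ> f) \<longlongrightarrow> l) at_infinity"
      by (simp add: lim_at_infinity_0 comp_def)
    then obtain a n where a: "\<And>z. f z = (\<Sum>i\<le>n. a i * z ^ i)"
      using pole_at_infinity[OF hol] by blast
    have "\<forall>z. f z = poly (\<Sum>i\<le>n. monom (a i) i) z"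
      by (simp add: a poly_sum poly_monom)
    with f show False
      unfolding transcendental_entire_def by blast
  qed
  moreover have "(f \<circ> inverse) holomorphic_on (UNIV - {0})"
    by (intro holomorphic_on_compose holomorphic_intros holomorphic_on_subset[OF hol]) auto
  ultimately obtain a
    where a: "\<And>w. w \<noteq> a \<Longrightarrow> infinite {x. x \<in> UNIV - {0} \<and> (f \<circ> inverse) x = w}"
    using great_Picard_infinite[of UNIV 0 "f \<circ> inverse"] by blast
  show ?thesis
  proof (rule that[of a])
    fix w assume "w \<noteq> a"
    have "infinite {z. f z = w}"
    proof
      assume "finite {z. f z = w}"
      moreover have "{x. x \<in> UNIV - {0} \<and> (f \<circ> inverse) x = w} \<subseteq> inverse ` {z. f z = w}"
        by (auto intro!: image_eqI[where x = "inverse x" for x])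
      ultimately show False
        using a[OF \<open>w \<noteq> a\<close>] by (meson finite_imageI finite_subset)
    qed
    have nc: "\<not> (\<lambda>z. f z - w) constant_on UNIV"
    proof
      assume "(\<lambda>z. f z - w) constant_on UNIV"
      then obtain c where "\<And>z. f z - w = c"
        by (auto simp: constant_on_def)
      then have "\<And>z. f z = c + w"
        by (metis diff_add_cancel)
      then show False
        using transcendental_not_constant[OF f] by (auto simp: constant_on_def)
    qed
    show "\<exists>\<^sub>F z in at_infinity. f z = w"
    proof (rule ccontr)
      assume "\<not> (\<exists>\<^sub>F z in at_infinity. f z = w)"
      then obtain R where R: "\<And>z. norm z \<ge> R \<Longrightarrow> f z \<noteq> w"
        by (auto simp: not_frequently eventually_at_infinity)
      have "finite {z \<in> cball 0 R. f z - w = 0}"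
        by (rule holomorphic_compact_finite_zeros[OF _ open_UNIV connected_UNIV _ _ nc])
           (auto intro!: holomorphic_intros hol)
      moreover have "{z. f z = w} \<subseteq> {z \<in> cball 0 R. f z - w = 0}"
        using R by (force simp: not_le)
      ultimately show False
        using \<open>infinite {z. f z = w}\<close> finite_subset by blast
    qed
  qed
qed

lemma frequently_eq_limits_unique:
  fixes f g :: "'a \<Rightarrow> 'b :: t2_space"
  assumes "(f \<longlongrightarrow> l) F" "(g \<longlongrightarrow> m) F" "\<exists>\<^sub>F x in F. f x = g x"
  shows "l = m"
proof (rule ccontr)
  assume "l \<noteq> m"
  then obtain U V where UV: "open U" "open V" "l \<in> U" "m \<in> V" "U \<inter> V = {}"
    by (meson hausdorff)
  have "\<forall>\<^sub>F x in F. f x \<in> U" "\<forall>\<^sub>F x in F. g x \<in> V"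
    using assms UV by (auto intro: topological_tendstoD)
  then have "\<forall>\<^sub>F x in F. f x \<noteq> g x"
    by eventually_elim (use UV in auto)
  with assms(3) show False
    by (simp add: frequently_def)
qed

text \<open>Suppose there were no such \<open>z\<close>. Then \<open>q z = (f (f z) - z) / (f z - z)\<close> is defined and omits
  \<open>0\<close> and \<open>1\<close> near infinity, so that by the great Picard theorem \<open>q\<close> has at most a pole there. At
  the solutions of \<open>f z = w\<close>, which tend to infinity for all \<open>w\<close> but one, \<open>q z\<close> is
  \<open>(f w - z) / (w - z)\<close>. This tends to \<open>1\<close>, and \<open>z * (q z - 1)\<close> tends to \<open>w - f w\<close>. As \<open>q\<close> is
  holomorphic at infinity with value \<open>1\<close>, the limit of \<open>z * (q z - 1)\<close> exists and does not depend
  on \<open>w\<close>, so \<open>f\<close> is a translation. Below, \<open>Q x\<close> is \<open>q (1 / x)\<close>.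

  This is a weak substitute for the theorem that \<open>f \<circ> f\<close> has infinitely many fixed points, and
  avoids value distribution theory beyond Picard.\<close>

lemma period_two_near_infinity:
  assumes f: "transcendental_entire f"
  obtains z where "norm z > R" "f (f z) \<in> {z, f z}"
proof -
  have False if no: "\<And>z. norm z > R \<Longrightarrow> f (f z) \<notin> {z, f z}"
  proof -
    have hol: "f holomorphic_on UNIV"
      using f by (simp add: transcendental_entire_def)
    obtain a where a: "\<And>w. w \<noteq> a \<Longrightarrow> \<exists>\<^sub>F z in at_infinity. f z = w"
      using transcendental_frequently_eq[OF f] by blast
    define r where "r = 1 / (\<bar>R\<bar> + 1)"
    have r: "r > 0"
      by (simp add: r_def)
    define Q where "Q = (\<lambda>x. (f (f (inverse x)) - inverse x) / (f (inverse x) - inverse x))"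
    have big: "norm (inverse x) > R" if "x \<in> ball 0 r - {0}" for x :: complex
    proof -
      have "norm x > 0" "norm x < 1 / (\<bar>R\<bar> + 1)"
        using that by (auto simp: r_def)
      then have "\<bar>R\<bar> + 1 < 1 / norm x"
        by (simp add: pos_less_divide_eq mult.commute)
      then show ?thesis
        by (simp add: norm_divide inverse_eq_divide)
    qed
    have ne: "f (inverse x) - inverse x \<noteq> 0" if "x \<in> ball 0 r - {0}" for x
    proof
      assume "f (inverse x) - inverse x = 0"
      then have "f (inverse x) = inverse x"
        by simp
      with no[OF big[OF that]] show False
        by simp
    qed
    have holQ: "Q holomorphic_on ball 0 r - {0}"
      unfolding Q_def
    proof (intro holomorphic_on_divide holomorphic_on_diff entire_compose[OF hol]
        holomorphic_on_inverse holomorphic_on_ident)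
    qed (use ne in auto)
    have "Q x \<noteq> 0 \<and> Q x \<noteq> 1" if "x \<in> ball 0 r - {0}" for x :: complex
      using no[OF big[OF that]] by (auto simp: Q_def divide_eq_1_iff)
    then obtain l where l: "(Q \<longlongrightarrow> l) (at 0) \<or> ((inverse \<circ> Q) \<longlongrightarrow> l) (at 0)"
      using great_Picard[of "ball 0 r" 0 0 1 Q] holQ r by auto
    \<comment> \<open>The value of \<open>Q x\<close> at the points with \<open>f (1 / x) = w\<close>.\<close>
    define T where "T = (\<lambda>w x. (x * f w - 1) / (x * w - 1))"
    have T1: "(T w \<longlongrightarrow> 1) (at 0)" for w
    proof -
      have "(T w \<longlongrightarrow> (0 * f w - 1) / (0 * w - 1)) (at 0)"
        unfolding T_def by (intro tendsto_intros) auto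
      then show ?thesis by simp
    qed
    have freq: "\<exists>\<^sub>F x in at 0. Q x = T w x \<and> x \<noteq> 0" if "w \<noteq> a" for w
    proof -
      have "\<exists>\<^sub>F z in at_infinity. f z = w \<and> norm z \<ge> 1"
        using a[OF that] by (rule frequently_eventually_frequently)
           (auto simp: eventually_at_infinity)
      then have "\<exists>\<^sub>F z in at_infinity. Q (inverse z) = T w (inverse z) \<and> inverse z \<noteq> 0"
      proof (rule frequently_elim1)
        fix z assume z: "f z = w \<and> norm z \<ge> 1"
        then have nz: "z \<noteq> 0" by auto
        have "T w (inverse z) = (z * (inverse z * f w - 1)) / (z * (inverse z * w - 1))"
          unfolding T_def using nz by (subst mult_divide_mult_cancel_left) auto
        also have "\<dots> = (f w - z) / (w - z)"
          using nz by (simp add: algebra_simps)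
        finally show "Q (inverse z) = T w (inverse z) \<and> inverse z \<noteq> 0"
          using z nz by (simp add: Q_def)
      qed
      then show ?thesis
        by (simp add: at_to_infinity frequently_def eventually_filtermap)
    qed
    obtain w0 where w0: "w0 \<noteq> a"
      by (metis zero_neq_one)
    have Q1: "(Q \<longlongrightarrow> 1) (at 0)"
      using l
    proof
      assume "(Q \<longlongrightarrow> l) (at 0)"
      moreover have "l = 1"
        by (rule frequently_eq_limits_unique[OF calculation T1[of w0]])
           (use freq[OF w0] in \<open>auto elim: frequently_elim1\<close>)
      ultimately show ?thesis by simp
    next
      assume inv: "((inverse \<circ> Q) \<longlongrightarrow> l) (at 0)"
      have "((\<lambda>x. inverse (T w0 x)) \<longlongrightarrow> inverse 1) (at 0)"
        by (intro tendsto_inverse T1) auto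
      then have "l = inverse 1"
        by (rule frequently_eq_limits_unique[OF inv])
           (use freq[OF w0] in \<open>auto elim: frequently_elim1\<close>)
      with inv have "((\<lambda>x. inverse ((inverse \<circ> Q) x)) \<longlongrightarrow> inverse 1) (at 0)"
        by (intro tendsto_inverse) (auto simp: comp_def)
      then show ?thesis by (simp add: comp_def)
    qed
    define Q' where "Q' = (\<lambda>x. if x = 0 then 1 else Q x)"
    have "Q' holomorphic_on ball 0 r"
      unfolding Q'_def by (rule removable_singularity[OF holQ _ Q1]) auto
    then obtain c where "(Q' has_field_derivative c) (at 0)"
      using r by (metis centre_in_ball holomorphic_derivI open_ball)
    then have c: "((\<lambda>x. (Q' x - 1) / x) \<longlongrightarrow> c) (at 0)"
      by (simp add: has_field_derivative_iff Q'_def)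
    have "f w = w - c" if "w \<noteq> a" for w
    proof -
      have "((\<lambda>x. (f w - w) / (x * w - 1)) \<longlongrightarrow> (f w - w) / (0 * w - 1)) (at 0)"
        by (intro tendsto_intros) auto
      moreover have "\<exists>\<^sub>F x in at 0. (Q' x - 1) / x = (f w - w) / (x * w - 1)"
      proof -
        have "\<forall>\<^sub>F x in at 0. x * w - 1 \<noteq> 0"
        proof -
          have "((\<lambda>x. x * w - 1) \<longlongrightarrow> 0 * w - 1) (at 0)"
            by (intro tendsto_intros)
          then show ?thesis
            by (rule tendsto_imp_eventually_ne) auto
        qed
        with freq[OF that] have "\<exists>\<^sub>F x in at 0. (Q x = T w x \<and> x \<noteq> 0) \<and> x * w - 1 \<noteq> 0"
          by (rule frequently_eventually_frequently)
        then show ?thesis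
          by (rule frequently_elim1) (auto simp: Q'_def T_def divide_simps algebra_simps)
      qed
      ultimately have "c = (f w - w) / (0 * w - 1)"
        using frequently_eq_limits_unique[OF c] by blast
      then show ?thesis by (simp add: algebra_simps)
    qed
    moreover have "f a - (a - c) = 0"
    proof -
      have "((\<lambda>w. f w - (w - c)) \<longlongrightarrow> f a - (a - c)) (at a)"
        using hol by (intro tendsto_intros)
          (meson UNIV_I continuous_on_eq_continuous_at holomorphic_on_imp_continuous_on isCont_def open_UNIV)
      moreover have "((\<lambda>w. f w - (w - c)) \<longlongrightarrow> 0) (at a)"
        by (rule tendsto_eventually) (auto simp: eventually_at_filter \<open>\<And>w. w \<noteq> a \<Longrightarrow> f w = w - c\<close>)
      ultimately show ?thesis
        using tendsto_unique[OF at_neq_bot] by blast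
    qed
    ultimately have "\<forall>w. f w = - c + 1 * w"
      by (metis add.commute diff_conv_add_uminus eq_iff_diff_eq_0 mult_1)
    then show False
      using transcendental_not_affine[OF f] by blast
  qed
  then show ?thesis
    using that by blast
qed

section \<open>Entire functions with locally bounded iterates\<close>

text \<open>The maximum principle in topological form. The image of the hull \<open>- outside T\<close> meets the
  connected set \<open>outside T\<close> in a relatively closed set, as the image is compact, and in a relatively
  open set, as only the image of the interior part \<open>inside T\<close> can meet it. An unbounded set is not
  covered by a compact image, so the intersection is empty.\<close>

lemma filled_hull_forward_invariant:
  fixes f :: "complex \<Rightarrow> complex"
  assumes hol: "f holomorphic_on UNIV" and nc: "\<not> f constant_on UNIV"
    and T: "compact T" "f ` T \<subseteq> T"
  shows "f ` (- outside T) \<subseteq> - outside T"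
proof -
  have bT: "bounded T" and cT: "closed T"
    using T compact_imp_bounded compact_imp_closed by auto
  have K: "- outside T = T \<union> inside T"
    by (simp add: union_with_inside)
  have "compact (- outside T)"
    using bounded_inside[OF bT] bT open_outside[OF cT]
    by (metis K bounded_Un closed_Compl compact_eq_bounded_closed)
  then have cf: "compact (f ` (- outside T))"
    using hol by (meson compact_continuous_image holomorphic_on_imp_continuous_on
      holomorphic_on_subset subset_UNIV)
  have "outside T \<inter> f ` (- outside T) = outside T \<inter> f ` inside T"
    using T(2) outside_no_overlap[of T] unfolding K by blast
  moreover have "open (f ` inside T)"
    using open_mapping_thm[OF hol open_UNIV connected_UNIV open_inside[OF cT] subset_UNIV nc] .
  ultimately have "openin (top_of_set (outside T)) (outside T \<inter> f ` (- outside T))"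
    by (simp add: openin_open_Int)
  moreover have "closedin (top_of_set (outside T)) (outside T \<inter> f ` (- outside T))"
    using cf by (simp add: closedin_closed_Int compact_imp_closed)
  ultimately have "outside T \<inter> f ` (- outside T) = {} \<or> outside T \<inter> f ` (- outside T) = outside T"
    using connected_outside[OF bT] by (simp add: connected_clopen)
  moreover have "outside T \<inter> f ` (- outside T) \<noteq> outside T"
    using unbounded_outside[OF bT] compact_imp_bounded[OF cf] by (metis bounded_Int inf_commute)
  ultimately show ?thesis
    by blast
qed

lemma connected_unbounded_norm_values:
  fixes A :: "'a :: real_normed_vector set"
  assumes "connected A" "\<not> bounded A" "Inf (norm ` A) < s"
  obtains w where "w \<in> A" "norm w = s"
proof -
  have "A \<noteq> {}"
    using assms(2) by auto
  then obtain x where x: "x \<in> A" "norm x < s"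
    using assms(3) cInf_lessD[of "norm ` A" s] by auto
  obtain y where y: "y \<in> A" "norm y > s"
    using assms(2) by (meson bounded_iff not_le)
  have "connected (norm ` A)"
    using assms(1) by (intro connected_continuous_image continuous_intros)
  then have "{norm x..norm y} \<subseteq> norm ` A"
    using x y by (intro connected_contains_Icc) auto
  moreover have "s \<in> {norm x..norm y}"
    using x y by simp
  ultimately show ?thesis
    using that by blast
qed

text \<open>Filling in the union of the forward images of a large disc gives a compact set \<open>K\<close> with
  \<open>f ` K \<subseteq> K\<close> and connected unbounded complement. Let \<open>d\<close> be the distance of \<open>0\<close> from the
  complement. Then \<open>f\<close> omits on the disc of radius \<open>d\<close> all points outside \<open>K\<close>, in particular
  some \<open>w\<close> and \<open>w'\<close> of modulus \<open>2 * d\<close> and \<open>4 * d\<close>. After rescaling, Schottky's theorem bounds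
  \<open>f\<close> on a smaller disc by an absolute constant times \<open>d\<close>.\<close>

lemma linear_growth_of_locally_bounded_iterates:
  assumes hol: "f holomorphic_on UNIV" and nc: "\<not> f constant_on UNIV"
    and bdd: "\<And>s. \<exists>M. \<forall>n. \<forall>z\<in>cball 0 s. norm ((f ^^ n) z) \<le> M"
  shows "\<exists>C. \<forall>r. \<exists>d\<ge>r. \<forall>z\<in>cball 0 (d / 4). norm (f z) \<le> C * d"
proof -
  \<comment> \<open>Schottky's bound on the disc of radius \<open>1/2\<close> for functions of modulus at most \<open>3/2\<close> at \<open>0\<close>.\<close>
  define S where "S = exp (pi * exp (pi * (2 + 2 * (3 / 2) + 12 * (1 / 2) / (1 - 1 / 2))))"
  have "\<exists>d\<ge>r. \<forall>z\<in>cball 0 (d / 4). norm (f z) \<le> (6 * S + 2) * d" for r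
  proof -
    define s where "s = max r (norm (f 0) + 1)"
    have s: "s > 0" "s \<ge> r" "s \<ge> norm (f 0)"
      using norm_ge_zero[of "f 0"] unfolding s_def by linarith+
    obtain M where M: "\<And>n z. z \<in> cball 0 s \<Longrightarrow> norm ((f ^^ n) z) \<le> M"
      using bdd[of s] by blast
    define W where "W = (\<Union>n. (f ^^ n) ` cball 0 s)"
    define T where "T = closure W"
    have sW: "cball 0 s \<subseteq> W"
      unfolding W_def by (rule order_trans[OF _ UN_upper[of 0]]) auto
    have "bounded W"
      unfolding W_def using M by (auto simp: bounded_iff intro!: exI[of _ M])
    then have cT: "compact T"
      by (simp add: T_def compact_closure)
    then have bT: "bounded T"
      by (rule compact_imp_bounded)
    have "f ` W \<subseteq> W"
    proof
      fix y assume "y \<in> f ` W"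
      then obtain n x where x: "x \<in> cball 0 s" "y = f ((f ^^ n) x)"
        by (auto simp: W_def)
      then have "y = (f ^^ Suc n) x"
        by simp
      with x show "y \<in> W"
        unfolding W_def by blast
    qed
    then have "f ` T \<subseteq> T"
      unfolding T_def using hol
      by (intro image_closure_subset)
        (auto intro: holomorphic_on_imp_continuous_on holomorphic_on_subset closure_subset
          dest: subsetD[OF closure_subset])
    note inv = filled_hull_forward_invariant[OF hol nc cT this]
    define d where "d = Inf (norm ` outside T)"
    have conn: "connected (outside T)" and unb: "\<not> bounded (outside T)"
      using connected_outside[OF bT] unbounded_outside[OF bT] by auto
    have ne: "outside T \<noteq> {}"
      using unb by auto
    have "s \<le> d"
      unfolding d_def
    proof (rule cInf_greatest)
      show "norm ` outside T \<noteq> {}"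
        using ne by simp
      fix x assume "x \<in> norm ` outside T"
      then obtain y where y: "y \<in> outside T" "x = norm y"
        by auto
      then have "y \<notin> T"
        using outside_no_overlap[of T] by blast
      then have "y \<notin> cball 0 s"
        using sW closure_subset unfolding T_def by blast
      then show "s \<le> x"
        using y by simp
    qed
    then have d: "d > 0" "d \<ge> r" "norm (f 0) \<le> d"
      using s by auto
    obtain w where w: "w \<in> outside T" "norm w = 2 * d"
      using connected_unbounded_norm_values[OF conn unb, of "2 * d"] d(1) unfolding d_def by auto
    obtain w' where w': "w' \<in> outside T" "norm w' = 4 * d"
      using connected_unbounded_norm_values[OF conn unb, of "4 * d"] d(1) unfolding d_def by auto
    have disc: "f z \<notin> outside T" if "norm z < d" for z
    proof -
      have "z \<notin> outside T"
      proof
        assume "z \<in> outside T"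
        then have "d \<le> norm z"
          unfolding d_def by (intro cInf_lower) (auto intro: bdd_belowI[of _ 0])
        with that show False by simp
      qed
      with inv show ?thesis by blast
    qed
    have ww: "2 * d \<le> norm (w' - w)" "norm (w' - w) \<le> 6 * d"
      using norm_triangle_ineq2[of w' w] norm_triangle_ineq4[of w' w] w w' by auto
    define F where "F = (\<lambda>x. (f (of_real (d / 2) * x) - w) / (w' - w))"
    have ne0: "w' - w \<noteq> 0"
      using ww d by auto
    have holF: "F holomorphic_on cball 0 1"
      unfolding F_def using ne0 by (intro holomorphic_intros entire_compose[OF hol]) auto
    have F0: "norm (F 0) \<le> 3 / 2"
    proof -
      have "norm (f 0 - w) \<le> 3 * d"
        using norm_triangle_ineq4[of "f 0" w] w d by simp
      also have "\<dots> \<le> 3 / 2 * norm (w' - w)"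
        using ww by simp
      finally show ?thesis
        using ne0 by (simp add: F_def norm_divide divide_le_eq)
    qed
    have F01: "\<not> (F x = 0 \<or> F x = 1)" if "x \<in> cball 0 1" for x
    proof -
      have "norm (of_real (d / 2) * x) \<le> d / 2"
        using that d by (simp add: norm_mult mult_left_le)
      then have "f (of_real (d / 2) * x) \<notin> outside T"
        using d by (intro disc) linarith
      then show ?thesis
        using w w' ne0 by (auto simp: F_def)
    qed
    have "norm (f z) \<le> (6 * S + 2) * d" if z: "z \<in> cball 0 (d / 4)" for z
    proof -
      have "norm (z / of_real (d / 2)) \<le> 1 / 2"
        using z d by (simp add: norm_divide field_simps)
      then have "norm (F (z / of_real (d / 2))) \<le> S"
        unfolding S_def by (intro Schottky[OF holF F0 F01, of "1/2"]) auto
      moreover have "of_real (d / 2) * (z / of_real (d / 2)) = z"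
        using d by simp
      ultimately have "norm ((f z - w) / (w' - w)) \<le> S"
        unfolding F_def by metis
      then have "norm (f z - w) \<le> S * norm (w' - w)"
        using ne0 by (simp add: norm_divide divide_le_eq)
      also have "\<dots> \<le> S * (6 * d)"
        using ww by (intro mult_left_mono) (auto simp: S_def)
      finally have "norm (f z) \<le> S * (6 * d) + 2 * d"
        using norm_triangle_ineq2[of "f z" w] w by simp
      then show ?thesis
        by (simp add: algebra_simps)
    qed
    then show ?thesis
      using d by blast
  qed
  then show ?thesis
    by blast
qed

text \<open>Cauchy's estimates on arbitrarily large circles kill all Taylor coefficients from the second
  order on.\<close>

lemma affine_if_linear_growth_on_large_discs:
  assumes hol: "f holomorphic_on UNIV"
    and growth: "\<And>r. \<exists>d\<ge>r. \<forall>z\<in>cball 0 (d / 4). norm (f z) \<le> C * d"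
  shows "f z = f 0 + deriv f 0 * z"
proof -
  have zero: "(deriv ^^ n) f 0 = 0" if n: "n \<ge> 2" for n
  proof (rule ccontr)
    assume "(deriv ^^ n) f 0 \<noteq> 0"
    then have pos: "norm ((deriv ^^ n) f 0) > 0"
      by simp
    define A where "A = fact n * \<bar>C\<bar> * 4 ^ n"
    obtain d where d: "d \<ge> max 1 (A / norm ((deriv ^^ n) f 0) + 1)"
      and f: "\<And>z. z \<in> cball 0 (d / 4) \<Longrightarrow> norm (f z) \<le> C * d"
      using growth by blast
    have d1: "d \<ge> 1" "A / norm ((deriv ^^ n) f 0) < d"
      using d by auto
    have "norm ((deriv ^^ n) f 0) \<le> fact n * (C * d) / (d / 4) ^ n"
      by (rule Cauchy_inequality)
        (use d1 f hol in \<open>auto intro!: holomorphic_on_imp_continuous_on intro: holomorphic_on_subset\<close>)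
    also have "\<dots> \<le> fact n * (\<bar>C\<bar> * d) / (d / 4) ^ n"
      using d1 by (intro divide_right_mono mult_left_mono mult_right_mono) auto
    also have "\<dots> = A * d / d ^ n"
      by (simp add: A_def power_divide)
    also have "\<dots> \<le> A * d / d ^ 2"
      using d1 n by (intro divide_left_mono power_increasing) (auto simp: A_def)
    also have "\<dots> = A / d"
      by (simp add: power2_eq_square)
    finally have "norm ((deriv ^^ n) f 0) * d \<le> A"
      using d1 by (simp add: le_divide_eq)
    with d1 pos show False
      by (simp add: divide_less_eq mult.commute)
  qed
  have "(\<lambda>n. (deriv ^^ n) f 0 / fact n * (z - 0) ^ n) sums f z"
    by (rule holomorphic_power_series[where r = "norm z + 1"])
      (auto intro: holomorphic_on_subset[OF hol])
  moreover have "(\<lambda>n. (deriv ^^ n) f 0 / fact n * (z - 0) ^ n) sums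
      (\<Sum>n<2. (deriv ^^ n) f 0 / fact n * (z - 0) ^ n)"
    by (rule sums_finite) (auto simp: zero)
  ultimately show ?thesis
    by (simp add: sums_unique2 numeral_2_eq_2)
qed

section \<open>Normality and the blow-up property of the Julia set\<close>

text \<open>Only positive iterates: the identity need not belong to a semigroup containing \<open>f\<close>.\<close>

definition iterates :: "('a \<Rightarrow> 'a) \<Rightarrow> ('a \<Rightarrow> 'a) set" where
  "iterates f = range (\<lambda>n. f ^^ Suc n)"

lemma entire_funpow:
  assumes "f holomorphic_on UNIV"
  shows "(f ^^ n) holomorphic_on S"
proof (induction n)
  case 0
  show ?case by (simp add: id_def)
next
  case (Suc n)
  from entire_compose[OF assms this] show ?case
    by (simp add: comp_def)
qed

lemma normal_subsequence_if_bounded: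
  assumes "open S" "\<And>i::nat. F i holomorphic_on S"
    and "\<And>K. compact K \<Longrightarrow> K \<subseteq> S \<Longrightarrow> \<exists>B. \<forall>i. \<forall>z\<in>K. norm (F i z) \<le> B"
  obtains g r where "g holomorphic_on S" "strict_mono (r :: nat \<Rightarrow> nat)"
    "loc_unif_to_fun S (F \<circ> r) g"
proof -
  have 1: "\<And>h. h \<in> range F \<Longrightarrow> h holomorphic_on S"
    using assms(2) by auto
  have 2: "\<And>K. compact K \<Longrightarrow> K \<subseteq> S \<Longrightarrow> \<exists>B. \<forall>h\<in>range F. \<forall>z\<in>K. norm (h z) \<le> B"
    using assms(3) by auto
  obtain g r where "g holomorphic_on S" "strict_mono (r :: nat \<Rightarrow> nat)"
    "\<And>K. \<lbrakk>compact K; K \<subseteq> S\<rbrakk> \<Longrightarrow> uniform_limit K (F \<circ> r) g sequentially"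
    using Montel[OF assms(1) 1 2 order_refl] by metis
  then show ?thesis
    using that unfolding loc_unif_to_fun_def by blast
qed

text \<open>Hurwitz's theorem, with the constant limits included.\<close>

lemma limit_zero_free_unless_identically_zero:
  assumes S: "open S" "connected S" and hol: "\<And>i::nat. F i holomorphic_on S"
    and g: "g holomorphic_on S" and lim: "loc_unif_to_fun S F g"
    and nz: "\<And>i z. z \<in> S \<Longrightarrow> F i z \<noteq> 0" and x: "x \<in> S" "g x \<noteq> 0" and z: "z \<in> S"
  shows "g z \<noteq> 0"
proof (cases "g constant_on S")
  case True
  with x z show ?thesis
    by (metis constant_on_def)
next
  case False
  show ?thesis
    by (rule Hurwitz_no_zeros[OF S hol g _ False nz z])
      (use lim in \<open>auto simp: loc_unif_to_fun_def\<close>)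
qed

lemma uniform_limit_affine:
  fixes F :: "'i \<Rightarrow> 'b \<Rightarrow> 'c :: real_normed_algebra"
  assumes "uniform_limit K F g A"
  shows "uniform_limit K (\<lambda>n z. a + c * F n z) (\<lambda>z. a + c * g z) A"
  by (rule uniform_limit_add[OF uniform_limit_const
        bounded_linear.uniform_limit[OF bounded_linear_mult_right assms]])

text \<open>Montel's fundamental normality test. Normalise so that the omitted values are \<open>0\<close> and \<open>1\<close>.
  At a base point infinitely many of the functions \<open>G i\<close>, or infinitely many of their inverses
  \<open>I i\<close>, have modulus at most \<open>1\<close>; by Schottky's theorem these are locally bounded, and so have a
  convergent subsequence. If the inverses converge, Hurwitz's theorem says that their limit is
  zero-free, and the \<open>G i\<close> converge as well, or identically zero, and the \<open>G i\<close> tend to infinity.\<close>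

lemma normal_subsequence_omitting_two_values:
  assumes S: "open S" "connected S" and hol: "\<And>i::nat. F i holomorphic_on S"
    and ab: "a \<noteq> b" and omit: "\<And>i z. z \<in> S \<Longrightarrow> F i z \<noteq> a \<and> F i z \<noteq> b"
  shows "\<exists>r::nat \<Rightarrow> nat. strict_mono r \<and>
    ((\<exists>g. g holomorphic_on S \<and> loc_unif_to_fun S (F \<circ> r) g) \<or> loc_unif_to_infinity S (F \<circ> r))"
proof (cases "S = {}")
  case True
  then show ?thesis
    by (intro exI[of _ id]) (auto simp: loc_unif_to_infinity_def strict_mono_def)
next
  case False
  then obtain w where w: "w \<in> S" by blast
  define G where "G = (\<lambda>i z. (F i z - a) / (b - a))"
  define I where "I = (\<lambda>i z. inverse (G i z))"
  have holG: "G i holomorphic_on S" for i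
    unfolding G_def using ab by (intro holomorphic_intros hol) auto
  have G01: "G i z \<noteq> 0 \<and> G i z \<noteq> 1" if "z \<in> S" for i z
    using omit[OF that] ab by (auto simp: G_def)
  have holI: "I i holomorphic_on S" for i
    unfolding I_def using G01 by (intro holomorphic_intros holG) auto
  have I01: "I i z \<noteq> 0 \<and> I i z \<noteq> 1" if "z \<in> S" for i z
    using G01[OF that] by (auto simp: I_def)
  have FG: "F i = (\<lambda>z. a + (b - a) * G i z)" for i
    using ab by (auto simp: G_def)
  have "infinite {i. norm (G i w) \<le> 1} \<or> infinite {i. norm (I i w) \<le> 1}"
  proof -
    have "norm (G i w) \<le> 1 \<or> norm (I i w) \<le> 1" for i
      by (auto simp: I_def norm_inverse inverse_le_1_iff)
    then have "{i. norm (G i w) \<le> 1} \<union> {i. norm (I i w) \<le> 1} = UNIV"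
      by auto
    then show ?thesis
      by (metis finite_UnI infinite_UNIV_nat)
  qed
  then show ?thesis
  proof
    assume "infinite {i. norm (G i w) \<le> 1}"
    then obtain r1 :: "nat \<Rightarrow> nat" where r1: "strict_mono r1" "\<And>i. norm (G (r1 i) w) \<le> 1"
      using infinite_enumerate by blast
    have bdd: "\<exists>B. \<forall>i. \<forall>z\<in>K. norm ((G \<circ> r1) i z) \<le> B" if K: "compact K" "K \<subseteq> S" for K
    proof -
      obtain B where B: "\<And>h z. \<lbrakk>h \<in> range (G \<circ> r1); z \<in> K\<rbrakk> \<Longrightarrow> norm (h z) \<le> B"
        by (rule GPicard3[OF S w, of "range (G \<circ> r1)" "range G" K])
          (use holG G01 r1(2) K in auto)
      show ?thesis
        by (intro exI[of _ B] allI ballI B rangeI)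
    qed
    have hol1: "(G \<circ> r1) i holomorphic_on S" for i
      by (simp add: holG)
    obtain g r2 where g: "g holomorphic_on S" and r2: "strict_mono (r2 :: nat \<Rightarrow> nat)"
      and lim: "loc_unif_to_fun S (G \<circ> r1 \<circ> r2) g"
      by (rule normal_subsequence_if_bounded[OF S(1) hol1 bdd])
    have "loc_unif_to_fun S (F \<circ> (r1 \<circ> r2)) (\<lambda>z. a + (b - a) * g z)"
      unfolding loc_unif_to_fun_def
    proof (intro allI impI)
      fix K assume "compact K" "K \<subseteq> S"
      with lim have "uniform_limit K (G \<circ> r1 \<circ> r2) g sequentially"
        by (simp add: loc_unif_to_fun_def)
      from uniform_limit_affine[OF this, of a "b - a"]
      show "uniform_limit K (F \<circ> (r1 \<circ> r2)) (\<lambda>z. a + (b - a) * g z) sequentially"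
        by (simp add: FG comp_def)
    qed
    moreover have "(\<lambda>z. a + (b - a) * g z) holomorphic_on S"
      by (intro holomorphic_intros g)
    ultimately show ?thesis
      using strict_mono_o[OF r1(1) r2] by blast
  next
    assume "infinite {i. norm (I i w) \<le> 1}"
    then obtain r1 :: "nat \<Rightarrow> nat" where r1: "strict_mono r1" "\<And>i. norm (I (r1 i) w) \<le> 1"
      using infinite_enumerate by blast
    have bdd: "\<exists>B. \<forall>i. \<forall>z\<in>K. norm ((I \<circ> r1) i z) \<le> B" if K: "compact K" "K \<subseteq> S" for K
    proof -
      obtain B where B: "\<And>h z. \<lbrakk>h \<in> range (I \<circ> r1); z \<in> K\<rbrakk> \<Longrightarrow> norm (h z) \<le> B"
        by (rule GPicard3[OF S w, of "range (I \<circ> r1)" "range I" K])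
          (use holI I01 r1(2) K in auto)
      show ?thesis
        by (intro exI[of _ B] allI ballI B rangeI)
    qed
    have hol1: "(I \<circ> r1) i holomorphic_on S" for i
      by (simp add: holI)
    obtain g r2 where g: "g holomorphic_on S" and r2: "strict_mono (r2 :: nat \<Rightarrow> nat)"
      and lim: "loc_unif_to_fun S (I \<circ> r1 \<circ> r2) g"
      by (rule normal_subsequence_if_bounded[OF S(1) hol1 bdd])
    have r: "strict_mono (r1 \<circ> r2)"
      using strict_mono_o[OF r1(1) r2] .
    show ?thesis
    proof (cases "\<forall>z\<in>S. g z = 0")
      case True
      have "loc_unif_to_infinity S (F \<circ> (r1 \<circ> r2))"
        unfolding loc_unif_to_infinity_def
      proof (intro allI impI)
        fix K :: "complex set" and B :: real assume K: "compact K" "K \<subseteq> S"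
        \<comment> \<open>With \<open>y\<close> the value of \<open>G\<close>, this makes \<open>norm (inverse y) < e\<close> force \<open>norm (a + (b - a) * y) > B\<close>.\<close>
        define e where "e = norm (b - a) / (\<bar>B\<bar> + norm a + 1)"
        have pos: "\<bar>B\<bar> + norm a + 1 > 0"
          using norm_ge_zero[of a] by linarith
        then have "e > 0"
          using ab by (simp add: e_def)
        moreover have "uniform_limit K (I \<circ> r1 \<circ> r2) g sequentially"
          using lim K by (simp add: loc_unif_to_fun_def)
        ultimately have "\<forall>\<^sub>F n in sequentially. \<forall>z\<in>K. dist ((I \<circ> r1 \<circ> r2) n z) (g z) < e"
          by (rule uniform_limitD[rotated])
        then show "\<forall>\<^sub>F n in sequentially. \<forall>z\<in>K. norm ((F \<circ> (r1 \<circ> r2)) n z) > B"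
        proof (rule eventually_mono, intro ballI)
          fix n z assume *: "\<forall>z\<in>K. dist ((I \<circ> r1 \<circ> r2) n z) (g z) < e" and z: "z \<in> K"
          have zS: "z \<in> S" using z K by blast
          define y where "y = G (r1 (r2 n)) z"
          have y: "norm y > 0"
            using G01[OF zS] by (simp add: y_def)
          have "norm (inverse y) < e"
            using * z True zS by (auto simp: I_def y_def)
          then have "1 < e * norm y"
            using y by (simp add: norm_inverse inverse_eq_divide norm_divide pos_divide_less_eq)
          then have "\<bar>B\<bar> + norm a + 1 < norm (b - a) * norm y"
            using pos by (simp add: e_def field_simps)
          also have "\<dots> = norm ((a + (b - a) * y) - a)"
            by (simp add: norm_mult)
          also have "\<dots> \<le> norm (a + (b - a) * y) + norm a"
            by (rule norm_triangle_ineq4)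
          finally show "norm ((F \<circ> (r1 \<circ> r2)) n z) > B"
            by (simp add: FG y_def)
        qed
      qed
      then show ?thesis
        using r by blast
    next
      case False
      then obtain x where x: "x \<in> S" "g x \<noteq> 0" by blast
      have gnz: "g z \<noteq> 0" if "z \<in> S" for z
        by (rule limit_zero_free_unless_identically_zero[OF S _ g lim _ x that])
          (use holI I01 in auto)
      have "loc_unif_to_fun S (F \<circ> (r1 \<circ> r2)) (\<lambda>z. a + (b - a) * inverse (g z))"
        unfolding loc_unif_to_fun_def
      proof (intro allI impI)
        fix K assume K: "compact K" "K \<subseteq> S"
        have "\<exists>e>0. \<forall>z\<in>K. e \<le> norm (g z)"
        proof (cases "K = {}")
          case True
          then show ?thesis by (auto intro: exI[of _ 1])
        next
          case False
          have "continuous_on K (\<lambda>z. norm (g z))"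
            using g K by (intro continuous_intros)
              (metis holomorphic_on_imp_continuous_on holomorphic_on_subset)
          then obtain z0 where "z0 \<in> K" "\<forall>z\<in>K. norm (g z0) \<le> norm (g z)"
            using continuous_attains_inf[OF K(1) False] by blast
          then show ?thesis
            using gnz K by (intro exI[of _ "norm (g z0)"]) auto
        qed
        then obtain e where e: "e > 0" "\<And>z. z \<in> K \<Longrightarrow> e \<le> norm (g z)"
          by blast
        have "uniform_limit K (I \<circ> r1 \<circ> r2) g sequentially"
          using lim K by (simp add: loc_unif_to_fun_def)
        then have "uniform_limit K (\<lambda>n z. inverse ((I \<circ> r1 \<circ> r2) n z)) (\<lambda>z. inverse (g z)) sequentially"
          using uniform_lim_inverse[where S = K and f = "I \<circ> r1 \<circ> r2" and l = g and b = e] e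
          by (simp add: comp_def)
        from uniform_limit_affine[OF this, of a "b - a"]
        show "uniform_limit K (F \<circ> (r1 \<circ> r2)) (\<lambda>z. a + (b - a) * inverse (g z)) sequentially"
          by (simp add: FG comp_def I_def)
      qed
      moreover have "(\<lambda>z. a + (b - a) * inverse (g z)) holomorphic_on S"
        using gnz by (intro holomorphic_intros g) auto
      ultimately show ?thesis
        using r by blast
    qed
  qed
qed

text \<open>A sequence of iterates near \<open>f z\<close> is pulled back by composing with \<open>f\<close>; the result is again a
  sequence of iterates and has a subsequence that converges or tends to infinity near \<open>z\<close>. Upper
  or lower bounds on a disc around \<open>z\<close> become bounds on its image, which is a neighbourhood of
  \<open>f z\<close> by the open mapping theorem. In the case of upper bounds Montel's theorem restores a
  holomorphic limit there.\<close>

lemma fatou_set_forward_invariant: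
  assumes hol: "f holomorphic_on UNIV" and nc: "\<not> f constant_on UNIV"
    and z: "z \<in> fatou_set (iterates f)"
  shows "f z \<in> fatou_set (iterates f)"
proof -
  obtain U where U: "open U" "normal_on U (iterates f)" "z \<in> U"
    using z by (auto simp: fatou_set_def)
  then obtain e where e: "e > 0" "cball z e \<subseteq> U"
    by (meson open_contains_cball)
  define W where "W = f ` ball z e"
  have W: "open W" "f z \<in> W" "W \<subseteq> f ` cball z e"
    unfolding W_def using e open_mapping_thm[OF hol open_UNIV connected_UNIV open_ball subset_UNIV nc]
    by auto
  have "normal_on W (iterates f)"
    unfolding normal_on_def
  proof (intro allI impI)
    fix F :: "nat \<Rightarrow> complex \<Rightarrow> complex" assume F: "range F \<subseteq> iterates f"
    define F' where "F' = (\<lambda>i. F i \<circ> f)"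
    have "\<exists>k. F i = f ^^ Suc k" for i
      using F by (auto simp: iterates_def)
    then obtain k where k: "\<And>i. F i = f ^^ Suc (k i)"
      by metis
    then have "F' i = f ^^ Suc (Suc (k i))" for i
      unfolding F'_def by (metis funpow_Suc_right)
    then have "range F' \<subseteq> iterates f"
      unfolding iterates_def by (metis image_subsetI rangeI)
    then obtain r :: "nat \<Rightarrow> nat" where r: "strict_mono r"
      and lim: "(\<exists>g. g holomorphic_on U \<and> loc_unif_to_fun U (F' \<circ> r) g) \<or>
        loc_unif_to_infinity U (F' \<circ> r)"
      using U(2) unfolding normal_on_def by blast
    show "\<exists>r. strict_mono r \<and> ((\<exists>g. g holomorphic_on W \<and> loc_unif_to_fun W (F \<circ> r) g) \<or>
        loc_unif_to_infinity W (F \<circ> r))"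
      using lim
    proof
      assume "\<exists>g. g holomorphic_on U \<and> loc_unif_to_fun U (F' \<circ> r) g"
      then obtain g where g: "g holomorphic_on U" "loc_unif_to_fun U (F' \<circ> r) g"
        by blast
      have "compact (g ` cball z e)"
        using g e by (meson compact_cball compact_continuous_image
          holomorphic_on_imp_continuous_on holomorphic_on_subset)
      then obtain B where B: "\<And>x. x \<in> cball z e \<Longrightarrow> norm (g x) \<le> B"
        unfolding bounded_iff by (metis bounded_iff compact_imp_bounded image_eqI)
      have "uniform_limit (cball z e) (F' \<circ> r) g sequentially"
        using g e by (auto simp: loc_unif_to_fun_def)
      from uniform_limitD[OF this zero_less_one] obtain N
        where N: "\<And>n x. n \<ge> N \<Longrightarrow> x \<in> cball z e \<Longrightarrow> dist ((F' \<circ> r) n x) (g x) < 1"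
        unfolding eventually_sequentially by blast
      \<comment> \<open>Dropping finitely many terms makes the bound hold for all indices.\<close>
      define r' where "r' = (\<lambda>n. r (n + N))"
      have r': "strict_mono r'"
        using r by (auto simp: r'_def strict_mono_def)
      have "norm ((F \<circ> r') i y) \<le> B + 1" if y: "y \<in> W" for i y
      proof -
        obtain x where x: "x \<in> cball z e" "y = f x"
          using y W(3) by blast
        have "norm ((F' \<circ> r) (i + N) x - g x) < 1"
          using N[of "i + N" x] x by (simp add: dist_norm)
        then have "norm ((F' \<circ> r) (i + N) x) \<le> norm (g x) + 1"
          using norm_triangle_ineq2[of "(F' \<circ> r) (i + N) x" "g x"] by linarith
        also have "\<dots> \<le> B + 1"
          using B[OF x(1)] by simp
        finally show ?thesis
          by (simp add: F'_def r'_def x)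
      qed
      then have bdd: "\<exists>B. \<forall>i. \<forall>y\<in>K. norm ((F \<circ> r') i y) \<le> B" if "K \<subseteq> W" for K
        using that by blast
      have "(F \<circ> r') i holomorphic_on W" for i
        unfolding comp_def k by (rule entire_funpow[OF hol])
      from normal_subsequence_if_bounded[OF W(1) this bdd]
      obtain g' r'' where g': "g' holomorphic_on W" and r'': "strict_mono (r'' :: nat \<Rightarrow> nat)"
        and lim': "loc_unif_to_fun W (F \<circ> r' \<circ> r'') g'"
        by blast
      show ?thesis
      proof (intro exI[of _ "r' \<circ> r''"] conjI disjI1 exI[of _ g'])
        show "strict_mono (r' \<circ> r'')"
          using r' r'' by (rule strict_mono_o)
        show "loc_unif_to_fun W (F \<circ> (r' \<circ> r'')) g'"
          using lim' by (simp only: comp_assoc)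
      qed (rule g')
    next
      assume inf: "loc_unif_to_infinity U (F' \<circ> r)"
      have "loc_unif_to_infinity W (F \<circ> r)"
        unfolding loc_unif_to_infinity_def
      proof (intro allI impI)
        fix K :: "complex set" and B :: real assume K: "compact K" "K \<subseteq> W"
        have "\<forall>\<^sub>F n in sequentially. \<forall>x\<in>cball z e. norm ((F' \<circ> r) n x) > B"
          using inf e by (auto simp: loc_unif_to_infinity_def)
        then show "\<forall>\<^sub>F n in sequentially. \<forall>y\<in>K. norm ((F \<circ> r) n y) > B"
        proof (rule eventually_mono, intro ballI)
          fix n y assume *: "\<forall>x\<in>cball z e. norm ((F' \<circ> r) n x) > B" and "y \<in> K"
          then obtain x where "x \<in> cball z e" "y = f x"
            using K W by blast
          with * show "norm ((F \<circ> r) n y) > B"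
            by (auto simp: F'_def)
        qed
      qed
      with r show ?thesis by blast
    qed
  qed
  with W show ?thesis
    by (auto simp: fatou_set_def)
qed

lemma julia_set_backward_invariant:
  assumes hol: "f holomorphic_on UNIV" and nc: "\<not> f constant_on UNIV"
    and "(f ^^ n) z \<in> julia_set (iterates f)"
  shows "z \<in> julia_set (iterates f)"
  using assms(3)
proof (induction n)
  case (Suc n)
  then show ?case
    using fatou_set_forward_invariant[OF hol nc] by (auto simp: julia_set_def)
qed auto

lemma closed_julia_set: "closed (julia_set H)"
  unfolding julia_set_def fatou_set_def by (intro closed_Compl open_Union) auto

text \<open>Otherwise the iterates from the \<open>N\<close>-th on omit \<open>a\<close> and \<open>b\<close> near \<open>z\<close> and form a normal family
  by Montel's test. The finitely many earlier iterates do not affect normality: a sequence that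
  contains them infinitely often has a constant subsequence.\<close>

lemma julia_set_hits_one_of_two:
  assumes hol: "f holomorphic_on UNIV"
    and z: "z \<in> julia_set (iterates f)" and U: "open U" "z \<in> U" and ab: "a \<noteq> b"
  shows "\<exists>n\<ge>N. \<exists>w\<in>U. (f ^^ n) w \<in> {a, b}"
proof (rule ccontr)
  assume no: "\<not> ?thesis"
  obtain e where e: "e > 0" "ball z e \<subseteq> U"
    using U by (meson openE)
  have "normal_on (ball z e) (iterates f)"
    unfolding normal_on_def
  proof (intro allI impI)
    fix F :: "nat \<Rightarrow> complex \<Rightarrow> complex" assume F: "range F \<subseteq> iterates f"
    then have "\<exists>k. F i = f ^^ Suc k" for i
      by (auto simp: iterates_def)
    then obtain k where k: "\<And>i. F i = f ^^ Suc (k i)"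
      by metis
    let ?conv = "\<lambda>r. (\<exists>g. g holomorphic_on ball z e \<and> loc_unif_to_fun (ball z e) (F \<circ> r) g) \<or>
        loc_unif_to_infinity (ball z e) (F \<circ> r)"
    show "\<exists>r::nat \<Rightarrow> nat. strict_mono r \<and> ?conv r"
    proof (cases "infinite {i. k i \<ge> N}")
      case True
      then obtain r1 :: "nat \<Rightarrow> nat" where r1: "strict_mono r1" "\<And>i. k (r1 i) \<ge> N"
        using infinite_enumerate by blast
      have omit: "(F \<circ> r1) i x \<noteq> a \<and> (F \<circ> r1) i x \<noteq> b" if x: "x \<in> ball z e" for i x
      proof -
        have "N \<le> Suc (k (r1 i))"
          using r1(2)[of i] by simp
        then have "(f ^^ Suc (k (r1 i))) x \<notin> {a, b}"
          using no x e by blast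
        then show ?thesis
          by (simp add: k)
      qed
      have hol1: "(F \<circ> r1) i holomorphic_on ball z e" for i
        unfolding comp_def k by (rule entire_funpow[OF hol])
      have "\<exists>r::nat \<Rightarrow> nat. strict_mono r \<and> ?conv (r1 \<circ> r)"
        by (rule normal_subsequence_omitting_two_values[where F = "F \<circ> r1" and S = "ball z e",
          unfolded comp_assoc, OF open_ball connected_ball hol1 ab]) (use omit in blast)
      then obtain r2 :: "nat \<Rightarrow> nat" where r2: "strict_mono r2" "?conv (r1 \<circ> r2)"
        by (elim exE conjE)
      show ?thesis
        by (rule exI[of _ "r1 \<circ> r2"], rule conjI[OF strict_mono_o[OF r1(1) r2(1)] r2(2)])
    next
      case False
      then have "infinite {i. k i < N}"
        by (simp add: finite_compl not_le[symmetric] Collect_neg_eq)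
      moreover have "finite (k ` {i. k i < N})"
        by (rule finite_subset[of _ "{..<N}"]) auto
      ultimately obtain i0 where "infinite {i \<in> {i. k i < N}. k i = k i0}"
        using pigeonhole_infinite by blast
      then obtain r :: "nat \<Rightarrow> nat" where r: "strict_mono r" "\<And>i. k (r i) = k i0"
        using infinite_enumerate by blast
      have "F \<circ> r = (\<lambda>_. f ^^ Suc (k i0))"
        using r(2) k by auto
      then have "loc_unif_to_fun (ball z e) (F \<circ> r) (f ^^ Suc (k i0))"
        by (auto simp: loc_unif_to_fun_def uniform_limit_iff)
      then show ?thesis
        using r(1) entire_funpow[OF hol] by blast
    qed
  qed
  then have "z \<in> fatou_set (iterates f)"
    using e unfolding fatou_set_def by (auto intro!: exI[of _ "ball z e"])
  with z show False
    by (simp add: julia_set_def)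
qed

text \<open>By backward invariance the point that is mapped to \<open>a\<close> or \<open>b\<close> lies in the Julia set
  itself. There are two target points because a single one may be avoided: for \<open>z * exp z\<close> the point
  \<open>0\<close> is reached only from itself.\<close>

lemma julia_set_blow_up:
  assumes hol: "f holomorphic_on UNIV" and nc: "\<not> f constant_on UNIV"
    and z: "z \<in> julia_set (iterates f)" and U: "open U" "z \<in> U"
    and ab: "a \<in> julia_set (iterates f)" "b \<in> julia_set (iterates f)" "a \<noteq> b"
  obtains n w where "n \<ge> N" "w \<in> U" "w \<in> julia_set (iterates f)" "(f ^^ n) w \<in> {a, b}"
proof -
  obtain n w where nw: "n \<ge> N" "w \<in> U" "(f ^^ n) w \<in> {a, b}"
    using julia_set_hits_one_of_two[OF hol z U ab(3), of N] by blast
  then have "(f ^^ n) w \<in> julia_set (iterates f)"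
    using ab by blast
  then have "w \<in> julia_set (iterates f)"
    by (rule julia_set_backward_invariant[OF hol nc])
  with nw show ?thesis
    using that by blast
qed

section \<open>The Julia set of a transcendental entire function is unbounded\<close>

text \<open>If the iterates were unbounded on \<open>K\<close>, a sequence of them with growing values on \<open>K\<close>
  could have no subsequence with a finite limit, while the bounded orbit of \<open>x\<close> prevents
  convergence to infinity.\<close>

lemma bounded_orbit_spreads:
  assumes V: "normal_on V (iterates f)" and K: "compact K" "K \<subseteq> V"
    and x: "x \<in> V" "\<And>n. norm ((f ^^ n) x) \<le> M"
  shows "\<exists>B. \<forall>n. \<forall>y\<in>K. norm ((f ^^ n) y) \<le> B"
proof (rule ccontr)
  assume no: "\<not> ?thesis"
  obtain B0 where B0: "\<And>y. y \<in> K \<Longrightarrow> norm y \<le> B0"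
    using compact_imp_bounded[OF K(1)] by (auto simp: bounded_iff)
  have "\<exists>n y. y \<in> K \<and> norm ((f ^^ n) y) > max B0 (real i)" for i
    using no by (meson not_le)
  then obtain n y where ny: "\<And>i. y i \<in> K" "\<And>i. norm ((f ^^ n i) (y i)) > max B0 (real i)"
    by metis
  \<comment> \<open>The bound \<open>B0\<close> on \<open>K\<close> was put into the maximum to exclude the identity.\<close>
  have "n i \<noteq> 0" for i
    using ny(2)[of i] B0[OF ny(1)[of i]] by (intro notI) simp
  then have "\<exists>k. f ^^ n i = f ^^ Suc k" for i
    by (metis not0_implies_Suc)
  then have "range (\<lambda>i. f ^^ n i) \<subseteq> iterates f"
    unfolding iterates_def by (metis image_subsetI rangeI)
  then obtain r :: "nat \<Rightarrow> nat" where r: "strict_mono r"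
    and lim: "(\<exists>g. g holomorphic_on V \<and> loc_unif_to_fun V ((\<lambda>i. f ^^ n i) \<circ> r) g) \<or>
      loc_unif_to_infinity V ((\<lambda>i. f ^^ n i) \<circ> r)"
    using V unfolding normal_on_def by blast
  from lim show False
  proof
    assume "\<exists>g. g holomorphic_on V \<and> loc_unif_to_fun V ((\<lambda>i. f ^^ n i) \<circ> r) g"
    then obtain g where g: "g holomorphic_on V" "loc_unif_to_fun V ((\<lambda>i. f ^^ n i) \<circ> r) g"
      by blast
    have "compact (g ` K)"
      using g K by (meson compact_continuous_image
        holomorphic_on_imp_continuous_on holomorphic_on_subset)
    then obtain B where B: "\<And>y. y \<in> K \<Longrightarrow> norm (g y) \<le> B"
      unfolding bounded_iff by (metis bounded_iff compact_imp_bounded image_eqI)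
    have "uniform_limit K ((\<lambda>i. f ^^ n i) \<circ> r) g sequentially"
      using g K by (auto simp: loc_unif_to_fun_def)
    from uniform_limitD[OF this zero_less_one] obtain N where
      N: "\<And>i y. i \<ge> N \<Longrightarrow> y \<in> K \<Longrightarrow> dist ((f ^^ n (r i)) y) (g y) < 1"
      unfolding eventually_sequentially comp_apply by blast
    define i where "i = max N (nat \<lceil>B + 1\<rceil>)"
    have i: "i \<ge> N" "real i \<ge> B + 1"
      by (auto simp: i_def le_max_iff_disj) linarith
    have "norm ((f ^^ n (r i)) (y (r i)) - g (y (r i))) < 1"
      using N[OF i(1) ny(1)[of "r i"]] by (simp add: dist_norm)
    then have "norm ((f ^^ n (r i)) (y (r i))) \<le> B + 1"
      using norm_triangle_ineq2[of "(f ^^ n (r i)) (y (r i))" "g (y (r i))"] B[OF ny(1)[of "r i"]]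
      by linarith
    moreover have "real i \<le> real (r i)"
      using seq_suble[OF r] by simp
    ultimately show False
      using ny(2)[of "r i"] i by simp
  next
    assume "loc_unif_to_infinity V ((\<lambda>i. f ^^ n i) \<circ> r)"
    from this[unfolded loc_unif_to_infinity_def, rule_format, of "{x}" M]
    have "\<forall>\<^sub>F i in sequentially. norm ((f ^^ n (r i)) x) > M"
      using x(1) by simp
    then obtain i where "norm ((f ^^ n (r i)) x) > M"
      unfolding eventually_sequentially by blast
    with x(2)[of "n (r i)"] show False
      by simp
  qed
qed

text \<open>On the connected set \<open>norm z > R\<close> the points of bounded orbit form an open and relatively
  closed set, so all orbits there are bounded, locally uniformly. The bound on a large circle
  extends to the disc inside by the maximum principle.\<close>

lemma locally_bounded_iterates_if_bounded_orbit_near_infinity: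
  assumes hol: "f holomorphic_on UNIV" and R: "\<And>z. norm z > R \<Longrightarrow> z \<in> fatou_set (iterates f)"
    and x: "norm x > R" "\<And>n. norm ((f ^^ n) x) \<le> M"
  shows "\<exists>M. \<forall>n. \<forall>z\<in>cball 0 s. norm ((f ^^ n) z) \<le> M"
proof -
  define U :: "complex set" where "U = - cball 0 R"
  have U: "open U" "connected U"
    unfolding U_def by (auto intro!: connected_complement_bounded_convex)
  define A where "A = {z. \<exists>M. \<forall>n. norm ((f ^^ n) z) \<le> M}"
  have loc: "\<exists>e>0. ball z e \<subseteq> U \<and> ((\<exists>y\<in>ball z e. y \<in> A) \<longrightarrow>
      (\<exists>B. \<forall>n. \<forall>y\<in>ball z e. norm ((f ^^ n) y) \<le> B))" if z: "z \<in> U" for z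
  proof -
    obtain V where V: "open V" "normal_on V (iterates f)" "z \<in> V"
      using R[of z] z by (auto simp: fatou_set_def U_def)
    then obtain e where e: "e > 0" "cball z e \<subseteq> V \<inter> U"
      using U(1) z by (metis IntI open_Int open_contains_cball)
    have "\<exists>B. \<forall>n. \<forall>y\<in>ball z e. norm ((f ^^ n) y) \<le> B" if y: "y \<in> ball z e" "y \<in> A" for y
    proof -
      from y obtain M' where "\<And>n. norm ((f ^^ n) y) \<le> M'"
        by (auto simp: A_def)
      moreover have "y \<in> V" "cball z e \<subseteq> V"
        using y e ball_subset_cball by blast+
      ultimately have "\<exists>B. \<forall>n. \<forall>y\<in>cball z e. norm ((f ^^ n) y) \<le> B"
        using bounded_orbit_spreads[OF V(2) compact_cball] by blast
      then show ?thesis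
        using ball_subset_cball by blast
    qed
    moreover have "ball z e \<subseteq> U"
      using e ball_subset_cball by blast
    ultimately show ?thesis
      using e(1) by blast
  qed
  have "open (U \<inter> A)"
    unfolding open_contains_ball
  proof
    fix z assume z: "z \<in> U \<inter> A"
    then obtain e where "e > 0" "ball z e \<subseteq> U"
      "(\<exists>y\<in>ball z e. y \<in> A) \<longrightarrow> (\<exists>B. \<forall>n. \<forall>y\<in>ball z e. norm ((f ^^ n) y) \<le> B)"
      using loc by blast
    moreover from this z have "\<exists>y\<in>ball z e. y \<in> A"
      by (intro bexI[of _ z]) auto
    ultimately show "\<exists>e>0. ball z e \<subseteq> U \<inter> A"
      unfolding A_def by blast
  qed
  moreover have "open (U - A)"
    unfolding open_contains_ball
  proof
    fix z assume z: "z \<in> U - A"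
    then obtain e where e: "e > 0" "ball z e \<subseteq> U"
      "(\<exists>y\<in>ball z e. y \<in> A) \<longrightarrow> (\<exists>B. \<forall>n. \<forall>y\<in>ball z e. norm ((f ^^ n) y) \<le> B)"
      using loc by blast
    have "z \<in> A" if "\<exists>y\<in>ball z e. y \<in> A"
      using that e centre_in_ball[of z e] unfolding A_def by blast
    with z have "\<not> (\<exists>y\<in>ball z e. y \<in> A)"
      by blast
    with e show "\<exists>e>0. ball z e \<subseteq> U - A"
      by blast
  qed
  moreover have "x \<in> U \<inter> A"
    using x by (auto simp: U_def A_def)
  ultimately have UA: "U \<subseteq> A"
    using connectedD[OF U(2), of "U \<inter> A" "U - A"] by blast
  have "\<exists>e>0. \<exists>B. \<forall>n. \<forall>y\<in>ball z e. norm ((f ^^ n) y) \<le> B" if z: "z \<in> U" for z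
  proof -
    obtain e where "e > 0"
      "(\<exists>y\<in>ball z e. y \<in> A) \<longrightarrow> (\<exists>B. \<forall>n. \<forall>y\<in>ball z e. norm ((f ^^ n) y) \<le> B)"
      using loc[OF z] by blast
    moreover have "z \<in> A"
      using z UA by blast
    ultimately show ?thesis
      by (metis centre_in_ball)
  qed
  then obtain e B where eB: "\<And>z. z \<in> U \<Longrightarrow> e z > 0"
    "\<And>z n y. z \<in> U \<Longrightarrow> y \<in> ball z (e z) \<Longrightarrow> norm ((f ^^ n) y) \<le> B z"
    by metis
  define t where "t = \<bar>s\<bar> + \<bar>R\<bar> + 1"
  have tU: "sphere 0 t \<subseteq> U"
    by (auto simp: U_def t_def)
  have "z \<in> ball z (e z)" if "z \<in> sphere 0 t" for z
    using eB(1)[of z] tU that by auto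
  then have cover: "sphere 0 t \<subseteq> (\<Union>z\<in>sphere 0 t. ball z (e z))"
    by blast
  obtain C where C: "C \<subseteq> sphere 0 t" "finite C" "sphere 0 t \<subseteq> (\<Union>z\<in>C. ball z (e z))"
    by (rule compactE_image[OF compact_sphere open_ball cover])
  define M' where "M' = (\<Sum>z\<in>C. \<bar>B z\<bar>)"
  have sph: "norm ((f ^^ n) y) \<le> M'" if y: "y \<in> sphere 0 t" for n y
  proof -
    obtain z where z: "z \<in> C" "y \<in> ball z (e z)"
      using C y by blast
    then have "norm ((f ^^ n) y) \<le> B z"
      using eB(2) C tU by blast
    also have "\<dots> \<le> \<bar>B z\<bar>"
      by simp
    also have "\<dots> \<le> M'"
      unfolding M'_def using z C by (intro member_le_sum) auto
    finally show ?thesis .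
  qed
  have "norm ((f ^^ n) z) \<le> M'" if "z \<in> cball 0 s" for n z
  proof (rule maximum_modulus_frontier[where f = "f ^^ n" and S = "cball 0 t"])
    show "z \<in> cball 0 t"
      using that by (auto simp: t_def)
    show "continuous_on (closure (cball 0 t)) (f ^^ n)"
      by (intro holomorphic_on_imp_continuous_on entire_funpow hol)
  qed (use sph in \<open>auto intro: entire_funpow hol\<close>)
  then show ?thesis
    by blast
qed

text \<open>If the Julia set were bounded, a point of period at most two, or a preimage of a fixed point,
  near infinity would have a bounded orbit in the Fatou set. Then the iterates are locally bounded
  in the whole plane, so \<open>f\<close> grows at most linearly on large discs and is affine.\<close>

lemma unbounded_julia_set:
  assumes f: "transcendental_entire f"
  shows "\<not> bounded (julia_set (iterates f))"
proof
  assume "bounded (julia_set (iterates f))"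
  then obtain R where "\<And>z. z \<in> julia_set (iterates f) \<Longrightarrow> norm z \<le> R"
    by (auto simp: bounded_iff)
  then have R: "z \<in> fatou_set (iterates f)" if "norm z > R" for z
    using that by (force simp: julia_set_def)
  have hol: "f holomorphic_on UNIV"
    using f by (simp add: transcendental_entire_def)
  obtain x where x: "norm x > R" "f (f x) \<in> {x, f x}"
    using period_two_near_infinity[OF f] by blast
  have "(f ^^ n) x \<in> {x, f x}" for n
    by (induction n) (use x in auto)
  then have orb: "norm ((f ^^ n) x) \<le> max (norm x) (norm (f x))" for n
    by (metis insertE max.cobounded1 max.cobounded2 singletonD)
  obtain C where "\<And>r. \<exists>d\<ge>r. \<forall>z\<in>cball 0 (d / 4). norm (f z) \<le> C * d"
    using linear_growth_of_locally_bounded_iterates[OF hol transcendental_not_constant[OF f]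
      locally_bounded_iterates_if_bounded_orbit_near_infinity[OF hol R x(1) orb]] by blast
  from affine_if_linear_growth_on_large_discs[OF hol this] show False
    using transcendental_not_affine[OF f] by blast
qed

section \<open>Oscillating orbits in the Julia set\<close>

lemma dense_visits_in_julia_set:
  assumes hol: "f holomorphic_on UNIV" and nc: "\<not> f constant_on UNIV"
  defines "J \<equiv> julia_set (iterates f)"
  assumes V: "open V" and ab: "a \<in> J \<inter> V" "b \<in> J \<inter> V" "a \<noteq> b"
  shows "openin (top_of_set J) {w \<in> J. \<exists>n\<ge>N. (f ^^ n) w \<in> V} \<and>
    J \<subseteq> closure {w \<in> J. \<exists>n\<ge>N. (f ^^ n) w \<in> V}"
proof
  have "open ((f ^^ n) -` V)" for n
    by (rule open_vimage[OF V]) (intro holomorphic_on_imp_continuous_on entire_funpow hol)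
  then have "open (\<Union>n\<in>{N..}. (f ^^ n) -` V)"
    by blast
  moreover have "{w \<in> J. \<exists>n\<ge>N. (f ^^ n) w \<in> V} = J \<inter> (\<Union>n\<in>{N..}. (f ^^ n) -` V)"
    by auto
  ultimately show "openin (top_of_set J) {w \<in> J. \<exists>n\<ge>N. (f ^^ n) w \<in> V}"
    by (simp add: openin_open_Int)
  show "J \<subseteq> closure {w \<in> J. \<exists>n\<ge>N. (f ^^ n) w \<in> V}"
  proof
    fix z assume z: "z \<in> J"
    show "z \<in> closure {w \<in> J. \<exists>n\<ge>N. (f ^^ n) w \<in> V}"
      unfolding closure_approachable
    proof (intro allI impI)
      fix e :: real assume "e > 0"
      then obtain n w where "n \<ge> N" "w \<in> ball z e" "w \<in> J" "(f ^^ n) w \<in> {a, b}"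
        using julia_set_blow_up[OF hol nc, of z "ball z e" a b N] z ab unfolding J_def by auto
      then show "\<exists>y\<in>{w \<in> J. \<exists>n\<ge>N. (f ^^ n) w \<in> V}. dist y z < e"
        using ab by (intro bexI[of _ w]) (auto simp: dist_commute)
    qed
  qed
qed

text \<open>The Julia set is closed and hence a Baire space. Visiting a fixed disc that contains two of
  its points after time \<open>N\<close>, and leaving the disc of radius \<open>N\<close> after time \<open>N\<close>, are
  open dense conditions for every \<open>N\<close>; a point satisfying all of them oscillates.\<close>

lemma julia_set_contains_oscillating_orbit:
  assumes f: "transcendental_entire f"
  obtains z R where "z \<in> julia_set (iterates f)" "R > 0" "\<And>N. \<exists>n\<ge>N. norm ((f ^^ n) z) < R"
    "\<And>N B. \<exists>n\<ge>N. norm ((f ^^ n) z) > B"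
proof -
  define J where "J = julia_set (iterates f)"
  have hol: "f holomorphic_on UNIV" and nc: "\<not> f constant_on UNIV"
    using f transcendental_not_constant by (auto simp: transcendental_entire_def)
  have far: "\<exists>a\<in>J. norm a > B" for B
    using unbounded_julia_set[OF f] unfolding J_def bounded_iff by (meson not_le)
  have far2: "\<exists>a b. a \<in> J \<and> b \<in> J \<and> a \<noteq> b \<and> norm a > B \<and> norm b > B" for B
  proof -
    obtain a where a: "a \<in> J" "norm a > B"
      using far by blast
    obtain b where "b \<in> J" "norm b > norm a"
      using far by blast
    with a show ?thesis
      by (intro exI[of _ a] exI[of _ b]) auto
  qed
  obtain a b where ab: "a \<in> J" "b \<in> J" "a \<noteq> b"
    using far2 by blast
  define R where "R = norm a + norm b + 1"
  have R: "R > 0"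
    unfolding R_def using norm_ge_zero[of a] norm_ge_zero[of b] by linarith
  define P where "P = (\<lambda>N. {w \<in> J. \<exists>n\<ge>N. (f ^^ n) w \<in> ball 0 R})"
  define Q where "Q = (\<lambda>N. {w \<in> J. \<exists>n\<ge>N. (f ^^ n) w \<in> - cball 0 (real N)})"
  have P: "openin (top_of_set J) (P N) \<and> J \<subseteq> closure (P N)" for N
    unfolding P_def J_def
    by (rule dense_visits_in_julia_set[OF hol nc open_ball, of a _ _ b])
      (use ab in \<open>auto simp: J_def R_def add_nonneg_pos add_pos_nonneg\<close>)
  have Q: "openin (top_of_set J) (Q N) \<and> J \<subseteq> closure (Q N)" for N
  proof -
    obtain a b where "a \<in> J" "b \<in> J" "a \<noteq> b" "norm a > real N" "norm b > real N"
      using far2 by blast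
    then show ?thesis
      unfolding Q_def J_def
      by (intro dense_visits_in_julia_set[OF hol nc, of _ a b]) (auto simp: J_def)
  qed
  have "J \<subseteq> closure (\<Inter>(range P \<union> range Q))"
    by (rule Baire) (use P Q in \<open>auto simp: J_def closed_julia_set\<close>)
  then have "\<Inter>(range P \<union> range Q) \<noteq> {}"
    using ab by auto
  then obtain z where "z \<in> \<Inter>(range P \<union> range Q)"
    by blast
  then have z: "z \<in> P N" "z \<in> Q N" for N
    by blast+
  show ?thesis
  proof (rule that[of z R])
    show "z \<in> julia_set (iterates f)"
      using z(1)[of 0] by (simp add: P_def J_def)
    show "\<exists>n\<ge>N. norm ((f ^^ n) z) < R" for N
      using z(1)[of N] by (simp add: P_def)
    show "\<exists>n\<ge>N. norm ((f ^^ n) z) > B" for N B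
    proof -
      define k where "k = max N (nat \<lceil>B\<rceil>)"
      have k: "k \<ge> N" "real k \<ge> B"
        by (auto simp: k_def le_max_iff_disj) linarith
      obtain n where "n \<ge> k" "norm ((f ^^ n) z) > real k"
        using z(2)[of k] by (auto simp: Q_def)
      with k show ?thesis
        by (intro exI[of _ n]) auto
    qed
  qed (use R in auto)
qed

section \<open>From one generator to the semigroup\<close>

lemma funpow_mem_comp_semigroup:
  assumes "f \<in> G"
  shows "f ^^ Suc n \<in> comp_semigroup G"
proof (induction n)
  case 0
  show ?case
    using comp_semigroup.gen[OF assms] by (simp add: id_def[symmetric])
next
  case (Suc n)
  show ?case
    using comp_semigroup.comp[OF comp_semigroup.gen[OF assms] Suc.IH]
    by (simp only: funpow.simps(2)[of "Suc n"])
qed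

lemma countable_comp_semigroup:
  assumes "countable G"
  shows "countable (comp_semigroup G)"
proof (rule countable_subset)
  have app: "foldr (\<circ>) (xs @ ys) id = foldr (\<circ>) xs id \<circ> foldr (\<circ>) ys id" for xs ys :: "('a \<Rightarrow> 'a) list"
    by (induction xs) (auto simp: comp_assoc)
  show "comp_semigroup G \<subseteq> (\<lambda>xs. foldr (\<circ>) xs id) ` lists G"
  proof
    fix h assume "h \<in> comp_semigroup G"
    then show "h \<in> (\<lambda>xs. foldr (\<circ>) xs id) ` lists G"
    proof induction
      case (gen h)
      then show ?case
        by (intro image_eqI[of _ _ "[h]"]) auto
    next
      case (comp f g)
      then obtain xs ys where xy: "f = foldr (\<circ>) xs id" "g = foldr (\<circ>) ys id" "xs \<in> lists G" "ys \<in> lists G"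
        by blast
      then show ?case
        by (intro image_eqI[of _ _ "xs @ ys"]) (simp only: xy app, use xy in auto)
    qed
  qed
  show "countable ((\<lambda>xs. foldr (\<circ>) xs id) ` lists G)"
    using assms by (intro countable_image countable_lists)
qed

lemma julia_set_mono:
  assumes "H' \<subseteq> H"
  shows "julia_set H' \<subseteq> julia_set H"
proof -
  have "normal_on U H \<Longrightarrow> normal_on U H'" for U
    using assms unfolding normal_on_def by blast
  then show ?thesis
    unfolding julia_set_def fatou_set_def by blast
qed

text \<open>An orbit that repeats a value is eventually periodic and therefore finite.\<close>

lemma inj_orbit_if_unbounded:
  fixes f :: "'a :: real_normed_vector \<Rightarrow> 'a"
  assumes "\<And>B. \<exists>n. norm ((f ^^ n) z) > B"
  shows "inj (\<lambda>n. (f ^^ n) z)"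
proof (rule linorder_injI, rule notI)
  fix i j :: nat assume ij: "i < j" "(f ^^ i) z = (f ^^ j) z"
  have "(f ^^ n) z \<in> (\<lambda>n. (f ^^ n) z) ` {..<j}" for n
  proof (induction n rule: less_induct)
    case (less n)
    show ?case
    proof (cases "n < j")
      case False
      then have "(f ^^ n) z = (f ^^ (n - j)) ((f ^^ j) z)"
        by (metis comp_apply funpow_add le_add_diff_inverse2 not_less)
      also have "\<dots> = (f ^^ (n - j + i)) z"
        by (simp add: funpow_add ij(2))
      finally show ?thesis
        using less.IH[of "n - j + i"] False ij(1) by simp
    qed auto
  qed
  moreover have "bounded ((\<lambda>n. (f ^^ n) z) ` {..<j})"
    by (intro finite_imp_bounded) auto
  ultimately obtain B where "\<And>n. norm ((f ^^ n) z) \<le> B"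
    unfolding bounded_iff by blast
  with assms show False
    by (meson not_le)
qed

text \<open>An unbounded orbit makes the iterates of \<open>f\<close> pairwise distinct, so they occupy infinitely
  many places in the enumeration of \<open>H\<close>. These places need not be increasing in the order of
  iteration, whence the passage to subsequences along which they are.\<close>

lemma bungee_set_if_oscillating_orbit:
  assumes H: "countable H" "iterates f \<subseteq> H" and R: "R > 0"
    and low: "\<And>N. \<exists>n\<ge>N. norm ((f ^^ n) z) < R"
    and high: "\<And>N B. \<exists>n\<ge>N. norm ((f ^^ n) z) > B"
  shows "z \<in> bungee_set H"
proof -
  have fH: "f ^^ Suc n \<in> H" for n
    using H(2) by (auto simp: iterates_def)
  have "inj (\<lambda>n. (f ^^ n) z)"
    using inj_orbit_if_unbounded high by blast
  then have inj: "inj (\<lambda>n. f ^^ Suc n)"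
    by (intro injI) (metis Suc_inject injD)
  then have "infinite H"
    using fH by (meson finite_subset image_subsetI infinite_UNIV_nat finite_imageD)
  with H(1) have bij: "bij_betw (from_nat_into H) UNIV H"
    by (rule bij_betw_from_nat_into)
  define p where "p = (\<lambda>n. to_nat_on H (f ^^ Suc n))"
  have gp: "from_nat_into H (p n) = f ^^ Suc n" for n
    unfolding p_def using H(1) fH by (rule from_nat_into_to_nat_on)
  have injp: "inj p"
    by (intro injI) (metis gp inj injD)
  have "infinite {n. norm ((f ^^ Suc n) z) < R}"
    unfolding infinite_nat_iff_unbounded_le
  proof
    fix m
    obtain n where "n \<ge> Suc m" "norm ((f ^^ n) z) < R"
      using low by blast
    then show "\<exists>n\<ge>m. n \<in> {n. norm ((f ^^ Suc n) z) < R}"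
      by (intro exI[of _ "n - 1"]) (cases n, auto)
  qed
  then obtain r1 :: "nat \<Rightarrow> nat" where r1: "strict_mono r1" "\<And>i. norm ((f ^^ Suc (r1 i)) z) < R"
    using infinite_enumerate by blast
  have "inj (p \<circ> r1)"
    using injp strict_mono_imp_inj_on[OF r1(1)] by (rule inj_compose)
  then obtain s1 :: "nat \<Rightarrow> nat" where s1: "strict_mono (p \<circ> r1 \<circ> s1)"
    by (rule inj_nat_strict_mono_subseq)
  have "\<exists>r2. \<forall>k. norm ((f ^^ Suc (r2 k)) z) > real k \<and> r2 k < r2 (Suc k)"
  proof (rule dependent_nat_choice)
    show "\<exists>x. norm ((f ^^ Suc x) z) > real 0"
      using high[of 1 0] by (metis One_nat_def Suc_le_D of_nat_0)
    fix x k
    obtain n where "n \<ge> Suc (Suc x)" "norm ((f ^^ n) z) > real (Suc k)"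
      using high by blast
    then show "\<exists>y. norm ((f ^^ Suc y) z) > real (Suc k) \<and> x < y"
      by (intro exI[of _ "n - 1"]) (cases n, auto)
  qed
  then obtain r2 where r2: "\<And>k. norm ((f ^^ Suc (r2 k)) z) > real k" "strict_mono r2"
    by (auto simp: strict_mono_Suc_iff)
  have "inj (p \<circ> r2)"
    using injp strict_mono_imp_inj_on[OF r2(2)] by (rule inj_compose)
  then obtain s2 :: "nat \<Rightarrow> nat" where s2: "strict_mono s2" "strict_mono (p \<circ> r2 \<circ> s2)"
    by (rule inj_nat_strict_mono_subseq)
  have "filterlim (\<lambda>k. norm ((f ^^ Suc (r2 k)) z)) at_top sequentially"
    by (rule filterlim_at_top_mono[OF filterlim_real_sequentially])
      (use r2(1) less_imp_le in \<open>auto intro!: always_eventually\<close>)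
  then have lim: "filterlim (\<lambda>k. norm ((f ^^ Suc (r2 (s2 k))) z)) at_top sequentially"
    by (rule filterlim_compose[OF _ filterlim_subseq[OF s2(1)]])
  have "z \<in> bungee_seq (from_nat_into H)"
    unfolding bungee_seq_def mem_Collect_eq
    by (rule exI[of _ "p \<circ> r1 \<circ> s1"], rule exI[of _ "p \<circ> r2 \<circ> s2"], rule exI[of _ R])
      (use s1 s2(2) R r1(2) lim in \<open>simp add: gp del: funpow.simps\<close>)
  then show ?thesis
    using bungee_set_eq[OF bij] by simp
qed

theorem theorem4p4:
  fixes G :: "(complex \<Rightarrow> complex) set"
  assumes "G \<noteq> {}" and "countable G"
    and "\<And>h. h \<in> G \<Longrightarrow> transcendental_entire h"
  shows "bungee_set (comp_semigroup G) \<inter> julia_set (comp_semigroup G) \<noteq> {}"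
proof -
  obtain f where f: "f \<in> G"
    using assms(1) by blast
  obtain z R where z: "z \<in> julia_set (iterates f)" and R: "R > 0"
    "\<And>N. \<exists>n\<ge>N. norm ((f ^^ n) z) < R" "\<And>N B. \<exists>n\<ge>N. norm ((f ^^ n) z) > B"
    using julia_set_contains_oscillating_orbit[OF assms(3)[OF f]] by metis
  have sub: "iterates f \<subseteq> comp_semigroup G"
    unfolding iterates_def using funpow_mem_comp_semigroup[OF f] by blast
  have "z \<in> bungee_set (comp_semigroup G)"
    using bungee_set_if_oscillating_orbit[OF countable_comp_semigroup[OF assms(2)] sub R] .
  moreover have "z \<in> julia_set (comp_semigroup G)"
    using julia_set_mono[OF sub] z by blast
  ultimately show ?thesis
    by blast
qed

end
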